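(* For every circular arc graph $G$, $box(G) \leq r_{inf}(G) + 1$.
   Context: All graphs are simple, finite and undirected. A circular arc graph is a graph that is the intersection graph of a family of arcs on a circle: each vertex is assigned an arc, and two distinct vertices are adjacent if and only if their arcs intersect. (The whole circle and single points are not considered to be arcs.) For a family $F$ of arcs on a circle and a point $P$ of the circle, the overlap set $\mathcal{O}(P)$ is the set of all arcs of $F$ that contain $P$, and $r_{inf}(F)$ is the minimum of $|\mathcal{O}(P)|$ over all points $P$ of the circle. For a circular arc graph $G$, $r_{inf}(G)$ is the minimum value of $r_{inf}(F)$ over all families of arcs $F$ that represent $G$. A $k$-dimensional box (or $k$-box) is a Cartesian product $R_1 \times \cdots \times R_k$ where each $R_i$ is a closed interval on the real line. The boxicity $box(G)$ of a graph $G$ is the minimum integer $k$ such that $G$ is the intersection graph of a family of $k$-boxes (one box per vertex; two distinct vertices are adjacent if and only if their boxes intersect). *)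

theory Defs
  imports "HOL-Analysis.Analysis" "Graph_Theory.Pair_Digraph"
begin

text \<open>
  A finite simple undirected graph is a \<^locale>\<open>pair_graph\<close>: a finite, irreflexive, symmetric
  relation \<^const>\<open>parcs\<close> on a finite vertex set \<^const>\<open>pverts\<close>. What that library calls the
  arcs of a graph are its (directed) edges; they are unrelated to the circular arcs below.
\<close>

definition intersection_rep :: "'a pair_pre_digraph \<Rightarrow> ('a \<Rightarrow> 'b set) \<Rightarrow> bool" where
  "intersection_rep G F \<longleftrightarrow>
     (\<forall>u\<in>pverts G. \<forall>v\<in>pverts G. u \<noteq> v \<longrightarrow> ((u, v) \<in> parcs G \<longleftrightarrow> F u \<inter> F v \<noteq> {}))"


subsection \<open>Circular arc graphs\<close>

abbreviation unit_circle :: "complex set" where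
  "unit_circle \<equiv> sphere 0 1"

text \<open>
  An arc is swept out by the angles in a real interval. Each end of the interval may or may not
  belong to it, so closed, open and half-open arcs are all admitted; the whole circle and
  one-point sets (and the empty set) are not arcs.
\<close>

definition is_circular_arc :: "complex set \<Rightarrow> bool" where
  "is_circular_arc A \<longleftrightarrow>
     (\<exists>I :: real set. is_interval I \<and> A = cis ` I) \<and>
     A \<noteq> unit_circle \<and> (\<exists>p\<in>A. \<exists>q\<in>A. p \<noteq> q)"

definition circular_arc_rep :: "'a pair_pre_digraph \<Rightarrow> ('a \<Rightarrow> complex set) \<Rightarrow> bool" where
  "circular_arc_rep G F \<longleftrightarrow> (\<forall>v\<in>pverts G. is_circular_arc (F v)) \<and> intersection_rep G F"

definition circular_arc_graph :: "'a pair_pre_digraph \<Rightarrow> bool" where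
  "circular_arc_graph G \<longleftrightarrow> pair_graph G \<and> (\<exists>F. circular_arc_rep G F)"

text \<open>
  The family \<open>F\<close> is indexed by a set \<open>V\<close> of vertices and an arc is identified with its index, so
  that equal arcs assigned to different vertices are counted separately.
\<close>

definition overlap_set :: "'a set \<Rightarrow> ('a \<Rightarrow> complex set) \<Rightarrow> complex \<Rightarrow> 'a set" where
  "overlap_set V F P = {v \<in> V. P \<in> F v}"

definition r_inf_family :: "'a set \<Rightarrow> ('a \<Rightarrow> complex set) \<Rightarrow> nat" where
  "r_inf_family V F = (INF P\<in>unit_circle. card (overlap_set V F P))"

text \<open>For a set of natural numbers, \<^const>\<open>Inf\<close> is the minimum as soon as the set is nonempty.\<close>

definition r_inf :: "'a pair_pre_digraph \<Rightarrow> nat" where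
  "r_inf G = (INF F\<in>{F. circular_arc_rep G F}. r_inf_family (pverts G) F)"


subsection \<open>Boxicity\<close>

text \<open>
  Points of k-dimensional space are the functions on \<open>{..<k}\<close>. The only 0-box is the one-point
  space, so the graphs of boxicity 0 are exactly the complete graphs.
\<close>

definition is_box :: "nat \<Rightarrow> (nat \<Rightarrow> real) set \<Rightarrow> bool" where
  "is_box k B \<longleftrightarrow>
     (\<exists>R. (\<forall>i<k. \<exists>a b. a \<le> b \<and> R i = {a..b}) \<and> B = (\<Pi>\<^sub>E i\<in>{..<k}. R i))"

definition box_rep :: "'a pair_pre_digraph \<Rightarrow> nat \<Rightarrow> ('a \<Rightarrow> (nat \<Rightarrow> real) set) \<Rightarrow> bool" where
  "box_rep G k B \<longleftrightarrow> (\<forall>v\<in>pverts G. is_box k (B v)) \<and> intersection_rep G B"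

definition boxicity :: "'a pair_pre_digraph \<Rightarrow> nat" where
  "boxicity G = (LEAST k. \<exists>B. box_rep G k B)"

text \<open>Every graph has a box representation, so the minimum defining its boxicity is attained.\<close>

lemma box_rep_exists:
  assumes "pair_graph G"
  shows "\<exists>k B. box_rep G k B"
proof -
  interpret pair_graph G by fact
  define V where "V = pverts G"
  have "finite V" by (simp add: V_def pair_finite_verts)
  then obtain h where h: "bij_betw h V {..<card V}"
    using ex_bij_betw_finite_nat[of V] by (auto simp: atLeast0LessThan)
  define g where "g = inv_into V h"
  have gh: "g (h v) = v" if "v \<in> V" for v
    using h that by (simp add: g_def bij_betw_def)
  have hlt: "h v < card V" if "v \<in> V" for v
    using h that by (auto simp: bij_betw_def)
  define R where "R = (\<lambda>v i. {(if g i = v \<or> (g i, v) \<in> parcs G then 0 else 1 :: real)..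
    (if g i = v then 0 else 1)})"
  define B where "B = (\<lambda>v. \<Pi>\<^sub>E i\<in>{..<card V}. R v i)"
  have R: "\<exists>a b. a \<le> b \<and> R v i = {a..b}" for v i
    unfolding R_def by (rule exI, rule exI, rule conjI[rotated], rule refl) auto
  have "is_box (card V) (B v)" for v
    unfolding is_box_def B_def using R by blast
  moreover have "(u, v) \<in> parcs G \<longleftrightarrow> B u \<inter> B v \<noteq> {}"
    if u: "u \<in> V" and v: "v \<in> V" and "u \<noteq> v" for u v
  proof
    assume uv: "(u, v) \<in> parcs G"
    then have vu: "(v, u) \<in> parcs G"
      using pair_sym_arcs by (auto simp: symmetric_def dest: symD)
    define x where "x = restrict (\<lambda>i. if g i = u \<or> g i = v then 0 else 1 :: real) {..<card V}"
    have "x \<in> B u \<inter> B v"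
      using uv vu \<open>u \<noteq> v\<close> by (auto simp: x_def B_def R_def)
    then show "B u \<inter> B v \<noteq> {}" by blast
  next
    assume "B u \<inter> B v \<noteq> {}"
    then obtain x where "x \<in> B u" "x \<in> B v" by blast
    then have "x (h u) \<in> R u (h u)" "x (h u) \<in> R v (h u)"
      using hlt[OF u] by (auto simp: B_def)
    then show "(u, v) \<in> parcs G"
      using gh[OF u] \<open>u \<noteq> v\<close> by (auto simp: R_def split: if_splits)
  qed
  ultimately show ?thesis
    unfolding box_rep_def intersection_rep_def V_def by blast
qed

end

theory Submission
  imports Defs
begin

text \<open>
  Cut the circle at a point that lies on the fewest arcs. The arcs that avoid it become
  intervals of the line and need a single coordinate. Each vertex \<open>v\<close> whose arc contains the
  point costs one further coordinate, in which \<open>v\<close> is \<open>{0}\<close>, its neighbours are \<open>{0..1}\<close> and all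
  other vertices are \<open>{1}\<close>.
\<close>

definition is_closed_interval :: "real set \<Rightarrow> bool" where
  "is_closed_interval R \<longleftrightarrow> (\<exists>a b. a \<le> b \<and> R = {a..b})"

lemma is_closed_interval_atLeastAtMost: "a \<le> b \<Longrightarrow> is_closed_interval {a..b}"
  by (auto simp: is_closed_interval_def)

text \<open>Intersecting two products intersects them factor by factor, and a product is empty
  exactly when some factor is. So a box representation can be given and checked one coordinate at a
  time.\<close>

lemma boxicity_le:
  assumes R: "\<And>v i. v \<in> pverts G \<Longrightarrow> i < k \<Longrightarrow> is_closed_interval (R v i)"
    and adj: "\<And>u v. u \<in> pverts G \<Longrightarrow> v \<in> pverts G \<Longrightarrow> u \<noteq> v \<Longrightarrow>
      (u, v) \<in> parcs G \<longleftrightarrow> (\<forall>i<k. R u i \<inter> R v i \<noteq> {})"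
  shows "boxicity G \<le> k"
proof -
  define B where "B = (\<lambda>v. \<Pi>\<^sub>E i\<in>{..<k}. R v i)"
  have "is_box k (B v)" if "v \<in> pverts G" for v
    using R[OF that] by (auto simp: is_box_def B_def is_closed_interval_def)
  moreover have "B u \<inter> B v \<noteq> {} \<longleftrightarrow> (\<forall>i<k. R u i \<inter> R v i \<noteq> {})" for u v
    by (auto simp: B_def PiE_Int PiE_eq_empty_iff)
  ultimately have "box_rep G k B"
    using adj by (simp add: box_rep_def intersection_rep_def)
  then show ?thesis
    unfolding boxicity_def by (blast intro: Least_le)
qed

text \<open>The coordinate of \<open>w\<close> in \<open>S\<close> separates \<open>w\<close> from
  its non-neighbours and no other pair. The last coordinate carries the intervals \<open>I\<close>;
  there the vertices of \<open>S\<close> all get \<open>{a..b}\<close>, which meets every interval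
  in use, so it decides only the pairs outside \<open>S\<close>.\<close>

lemma boxicity_le_card_plus_1:
  assumes G: "pair_graph G" and "S \<subseteq> pverts G"
    and I: "\<And>v. v \<in> pverts G - S \<Longrightarrow> is_closed_interval (I v)"
    and adj: "\<And>u v. u \<in> pverts G - S \<Longrightarrow> v \<in> pverts G - S \<Longrightarrow> u \<noteq> v \<Longrightarrow>
      (u, v) \<in> parcs G \<longleftrightarrow> I u \<inter> I v \<noteq> {}"
    and bounded: "\<And>v. v \<in> pverts G - S \<Longrightarrow> I v \<subseteq> {a..b}" and "a \<le> b"
  shows "boxicity G \<le> card S + 1"
proof -
  interpret pair_graph G by fact
  have sym: "(u, v) \<in> parcs G \<longleftrightarrow> (v, u) \<in> parcs G" for u v
    using pair_sym_arcs by (auto simp: symmetric_def dest: symD)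
  have "finite S"
    using \<open>S \<subseteq> pverts G\<close> pair_finite_verts finite_subset by blast
  then obtain g where g: "bij_betw g {..<card S} S"
    using ex_bij_betw_nat_finite by (auto simp: atLeast0LessThan)
  \<comment> \<open>\<open>T v w\<close> is the interval of \<open>v\<close> in the coordinate of
    \<open>w\<close>. Among \<open>{0}\<close>, \<open>{0..1}\<close> and \<open>{1}\<close> only
    the first and the last are disjoint, and \<open>{0}\<close> belongs to \<open>w\<close>
    alone.\<close>
  define T where "T = (\<lambda>v w. {(if w = v \<or> (w, v) \<in> parcs G then 0 else 1 :: real)..
    (if w = v then 0 else 1)})"
  have T: "T u w \<inter> T v w \<noteq> {} \<longleftrightarrow> ((w = u \<longrightarrow> (u, v) \<in> parcs G) \<and> (w = v \<longrightarrow> (u, v) \<in> parcs G))"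
    if "u \<noteq> v" for u v w
    using that sym by (auto simp: T_def)
  define L where "L = (\<lambda>v. if v \<in> S then {a..b} else I v)"
  have L: "is_closed_interval (L v)" "L v \<noteq> {}" "L v \<subseteq> {a..b}" if "v \<in> pverts G" for v
  proof -
    show "is_closed_interval (L v)"
      using I[of v] \<open>a \<le> b\<close> that by (auto simp: L_def intro: is_closed_interval_atLeastAtMost)
    then show "L v \<noteq> {}" by (auto simp: is_closed_interval_def)
    show "L v \<subseteq> {a..b}" using bounded[of v] that by (simp add: L_def)
  qed
  \<comment> \<open>Indices below \<open>card S\<close> enumerate \<open>S\<close> through
    \<open>g\<close>; the one remaining index, \<open>card S\<close> itself, is the coordinate of
    \<open>L\<close>.\<close>
  define R where "R = (\<lambda>v i. if i < card S then T v (g i) else L v)"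
  show ?thesis
  proof (rule boxicity_le[where R = R])
    fix v i assume "v \<in> pverts G"
    moreover have "is_closed_interval (T v w)" for w
      unfolding T_def by (rule is_closed_interval_atLeastAtMost) simp
    ultimately show "is_closed_interval (R v i)"
      using L(1) by (simp add: R_def)
  next
    fix u v assume uv: "u \<in> pverts G" "v \<in> pverts G" "u \<noteq> v"
    have "(\<forall>i<card S + 1. R u i \<inter> R v i \<noteq> {}) \<longleftrightarrow>
        (\<forall>i<card S. T u (g i) \<inter> T v (g i) \<noteq> {}) \<and> L u \<inter> L v \<noteq> {}"
      by (auto simp: R_def less_Suc_eq)
    also have "(\<forall>i<card S. T u (g i) \<inter> T v (g i) \<noteq> {}) \<longleftrightarrow> (\<forall>w\<in>S. T u w \<inter> T v w \<noteq> {})"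
      using bij_betw_ball[OF g, of "\<lambda>w. T u w \<inter> T v w \<noteq> {}"]
      by (simp only: Ball_def lessThan_iff)
    also have "\<dots> \<longleftrightarrow> (u \<in> S \<or> v \<in> S \<longrightarrow> (u, v) \<in> parcs G)"
      using T[OF uv(3)] by blast
    also have "\<dots> \<and> L u \<inter> L v \<noteq> {} \<longleftrightarrow> (u, v) \<in> parcs G"
    proof (cases "u \<in> S \<or> v \<in> S")
      case True
      then have "L u \<inter> L v \<noteq> {}"
        using L(2,3)[OF uv(1)] L(2,3)[OF uv(2)] by (auto simp: L_def)
      then show ?thesis using True by blast
    next
      case False
      then show ?thesis using adj[of u v] uv by (simp add: L_def)
    qed
    finally show "(u, v) \<in> parcs G \<longleftrightarrow> (\<forall>i<card S + 1. R u i \<inter> R v i \<noteq> {})"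
      by simp
  qed
qed

text \<open>Arcs may lack endpoints, but boxes are closed. Pick a common point for each pair that
  meets and replace each \<open>J v\<close> by the hull of the finitely many points picked in it:
  the hull is closed, stays inside \<open>J v\<close> by convexity, and keeps every picked
  point.\<close>

lemma closed_interval_shrink:
  assumes "finite V" and J: "\<And>v. v \<in> V \<Longrightarrow> is_interval (J v)" "\<And>v. v \<in> V \<Longrightarrow> J v \<noteq> {}"
  obtains I :: "'a \<Rightarrow> real set" where "\<And>v. v \<in> V \<Longrightarrow> is_closed_interval (I v)"
    and "\<And>v. v \<in> V \<Longrightarrow> I v \<subseteq> J v"
    and "\<And>u v. u \<in> V \<Longrightarrow> v \<in> V \<Longrightarrow> I u \<inter> I v \<noteq> {} \<longleftrightarrow> J u \<inter> J v \<noteq> {}"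
proof -
  \<comment> \<open>The choice depends only on the set \<open>J u \<inter> J v\<close>, not on the
    order of the pair, so both members of the pair receive the same point.\<close>
  define p where "p = (\<lambda>X :: real set. SOME x. x \<in> X)"
  have p: "p X \<in> X" if "X \<noteq> {}" for X
    using that by (simp add: p_def some_in_eq)
  define S where "S = (\<lambda>v. (\<lambda>u. p (J u \<inter> J v)) ` {u \<in> V. J u \<inter> J v \<noteq> {}})"
  define I where "I = (\<lambda>v. {Min (S v)..Max (S v)})"
  have fin: "finite (S v)" for v
    using \<open>finite V\<close> by (simp add: S_def)
  have S_J: "S v \<subseteq> J v" for v
  proof
    fix x assume "x \<in> S v"
    then obtain u where "x = p (J u \<inter> J v)" "J u \<inter> J v \<noteq> {}"
      by (auto simp: S_def)
    then show "x \<in> J v" using p[of "J u \<inter> J v"] by simp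
  qed
  \<comment> \<open>The index \<open>u = v\<close> is allowed in \<open>S v\<close>, so even an
    interval that meets no other one contributes a point of its own.\<close>
  have ne: "S v \<noteq> {}" if "v \<in> V" for v
    using J(2)[OF that] that by (auto simp: S_def)
  have S_I: "S v \<subseteq> I v" for v
    using fin by (auto simp: I_def)
  have I_J: "I v \<subseteq> J v" if "v \<in> V" for v
  proof
    fix x assume "x \<in> I v"
    moreover have "Min (S v) \<in> J v" "Max (S v) \<in> J v"
      using fin ne[OF that] S_J Min_in Max_in by blast+
    ultimately show "x \<in> J v"
      using J(1)[OF that] by (auto simp: I_def intro: mem_is_interval_1_I)
  qed
  show thesis
  proof (rule that[of I])
    fix v assume "v \<in> V"
    then show "is_closed_interval (I v)"
      unfolding I_def using fin ne by (intro is_closed_interval_atLeastAtMost) simp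
    show "I v \<subseteq> J v" by (rule I_J) fact
  next
    fix u v assume uv: "u \<in> V" "v \<in> V"
    have "p (J u \<inter> J v) \<in> S u \<inter> S v" if "J u \<inter> J v \<noteq> {}"
      using uv that by (auto simp: S_def Int_commute)
    then show "I u \<inter> I v \<noteq> {} \<longleftrightarrow> J u \<inter> J v \<noteq> {}"
      using S_I I_J uv by blast
  qed
qed

lemma cis_eq_iff_int: "cis x = cis y \<longleftrightarrow> (\<exists>k::int. x = y + 2 * pi * k)"
  using sin_cos_eq_iff[of x y] by (auto simp: complex_eq_iff)

lemma cis_Arg_unit_circle: "z \<in> unit_circle \<Longrightarrow> cis (Arg z) = z"
  using rcis_cmod_Arg[of z] by (simp add: rcis_def)

text \<open>The circle unrolled from the cut point \<open>cis t\<close>. The window is one full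
  turn, open at both ends because both ends are angles of the cut point.\<close>

definition cut_open :: "real \<Rightarrow> complex set \<Rightarrow> real set" where
  "cut_open t A = {s \<in> {t<..<t + 2 * pi}. cis s \<in> A}"

lemma cis_image_cut_open:
  assumes "A \<subseteq> unit_circle" "cis t \<notin> A"
  shows "cis ` cut_open t A = A"
proof
  show "A \<subseteq> cis ` cut_open t A"
  proof
    fix z assume "z \<in> A"
    define s where "s = Arg z"
    have z: "z = cis s"
      using \<open>z \<in> A\<close> assms(1) cis_Arg_unit_circle by (metis s_def subsetD)
    \<comment> \<open>The number of full turns to remove from \<open>s\<close> so that the angle
      lands in \<open>{t..<t + 2 * pi}\<close>; the end \<open>t\<close> is ruled out afterwards
      because \<open>cis t\<close> is not in \<open>A\<close>.\<close>
    define k where "k = \<lfloor>(s - t) / (2 * pi)\<rfloor>"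
    define x where "x = s - 2 * pi * k"
    have "k \<le> (s - t) / (2 * pi)" "(s - t) / (2 * pi) < k + 1"
      unfolding k_def by linarith+
    then have "t \<le> x" "x < t + 2 * pi"
      by (simp_all add: x_def field_simps)
    moreover have "cis x = z"
      unfolding z cis_eq_iff_int x_def by (rule exI[of _ "-k"]) simp
    moreover have "x \<noteq> t"
      using \<open>cis x = z\<close> \<open>z \<in> A\<close> assms(2) by auto
    ultimately show "z \<in> cis ` cut_open t A"
      using \<open>z \<in> A\<close> by (auto simp: cut_open_def)
  qed
qed (auto simp: cut_open_def)

lemma cut_open_Int: "cut_open t (A \<inter> B) = cut_open t A \<inter> cut_open t B"
  by (auto simp: cut_open_def)

text \<open>Since \<open>I\<close> contains no angle of the cut point, it lies between two
  consecutive such angles. Hence one and the same number of turns carries all the angles found in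
  the window into \<open>I\<close>, and convexity is inherited from \<open>I\<close>.\<close>

lemma is_interval_cut_open:
  assumes I: "is_interval I" and t: "cis t \<notin> cis ` I"
  shows "is_interval (cut_open t (cis ` I))"
  unfolding is_interval_1
proof (intro ballI allI impI, elim conjE)
  fix x y s assume "x \<in> cut_open t (cis ` I)" "y \<in> cut_open t (cis ` I)" and s: "x \<le> s" "s \<le> y"
  then obtain k l :: int where x: "t < x" "x < t + 2 * pi" "x + 2 * pi * k \<in> I"
    and y: "t < y" "y < t + 2 * pi" "y + 2 * pi * l \<in> I"
    by (auto simp: cut_open_def cis_eq_iff_int) (metis cis_eq_iff_int)
  have no_cut: "t + 2 * pi * m \<notin> I" for m :: int
    using t by (metis cis_eq_iff_int image_eqI)
  \<comment> \<open>If \<open>i < j\<close>, the angle \<open>t + 2 * pi * (i + 1)\<close> of the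
    cut point would lie between two elements of \<open>I\<close>. Applied in both directions, this
    gives \<open>k = l\<close>.\<close>
  have no_wrap: "j \<le> i" if "t < v" "w < t + 2 * pi" "w + 2 * pi * i \<in> I" "v + 2 * pi * j \<in> I"
    for v w and i j :: int
  proof (rule ccontr)
    assume "\<not> j \<le> i"
    then have "2 * pi * (i + 1) \<le> 2 * pi * j"
      by (intro mult_left_mono) auto
    then have "w + 2 * pi * i \<le> t + 2 * pi * (i + 1)" "t + 2 * pi * (i + 1) \<le> v + 2 * pi * j"
      using that by (auto simp: algebra_simps)
    then have "t + 2 * pi * of_int (i + 1) \<in> I"
      using that I by (auto intro: mem_is_interval_1_I)
    then show False using no_cut by blast
  qed
  have "k = l"
    using no_wrap[OF x(1) y(2) y(3) x(3)] no_wrap[OF y(1) x(2) x(3) y(3)] by simp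
  then have "s + 2 * pi * k \<in> I"
    using x y s by (intro mem_is_interval_1_I[OF I x(3) y(3)]) auto
  moreover have "cis s = cis (s + 2 * pi * k)"
    by (subst cis_eq_iff_int) (rule exI[of _ "-k"], simp)
  ultimately show "s \<in> cut_open t (cis ` I)"
    using x y s by (auto simp: cut_open_def)
qed

text \<open>The bound holds for every representation and every point \<open>P\<close>. Cutting at
  \<open>P\<close> turns the arcs that avoid it into intervals with the same intersection pattern,
  all inside one window of length \<open>2 * pi\<close>; the vertices whose arcs contain
  \<open>P\<close> form the set \<open>S\<close>.\<close>

lemma boxicity_le_card_overlap_set:
  assumes G: "pair_graph G" and F: "circular_arc_rep G F" and P: "P \<in> unit_circle"
  shows "boxicity G \<le> card (overlap_set (pverts G) F P) + 1"
proof -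
  interpret pair_graph G by fact
  define S where "S = overlap_set (pverts G) F P"
  define V where "V = pverts G - S"
  obtain t where t: "P = cis t"
    using cis_Arg_unit_circle[OF P] by metis
  have arc: "is_circular_arc (F v)" if "v \<in> pverts G" for v
    using F that by (simp add: circular_arc_rep_def)
  have circle: "F v \<subseteq> unit_circle" if "v \<in> pverts G" for v
    using arc[OF that] by (auto simp: is_circular_arc_def)
  have cut: "cis t \<notin> F v" if "v \<in> V" for v
    using that by (auto simp: V_def S_def overlap_set_def t)
  define J where "J = (\<lambda>v. cut_open t (F v))"
  \<comment> \<open>\<open>cut_open\<close> commutes with intersection, and \<open>cis\<close> maps
    the unrolled \<open>F u \<inter> F v\<close> back onto it because \<open>F u\<close> avoids the
    cut, so emptiness agrees on both sides.\<close>
  have J_ne: "J u \<inter> J v \<noteq> {} \<longleftrightarrow> F u \<inter> F v \<noteq> {}" if "u \<in> V" "v \<in> V" for u v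
    using cis_image_cut_open[of "F u \<inter> F v" t] circle[of u] cut[of u] that
    by (auto simp: J_def V_def simp flip: cut_open_Int)
  have "is_interval (J v)" if "v \<in> V" for v
    using arc[of v] cut[OF that] that
    by (auto simp: J_def is_circular_arc_def V_def intro: is_interval_cut_open)
  \<comment> \<open>The case \<open>u = v\<close> of \<open>J_ne\<close>, as an arc has at least two
    points.\<close>
  moreover have "J v \<noteq> {}" if "v \<in> V" for v
    using J_ne[OF that that] arc[of v] that by (auto simp: V_def is_circular_arc_def)
  moreover have "finite V"
    by (simp add: V_def pair_finite_verts)
  ultimately obtain I where I: "\<And>v. v \<in> V \<Longrightarrow> is_closed_interval (I v)"
      "\<And>v. v \<in> V \<Longrightarrow> I v \<subseteq> J v"
      "\<And>u v. u \<in> V \<Longrightarrow> v \<in> V \<Longrightarrow> I u \<inter> I v \<noteq> {} \<longleftrightarrow> J u \<inter> J v \<noteq> {}"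
    using closed_interval_shrink[of V J] by metis
  have "boxicity G \<le> card S + 1"
  proof (rule boxicity_le_card_plus_1[OF G, where I = I])
    show "S \<subseteq> pverts G" by (auto simp: S_def overlap_set_def)
    show "is_closed_interval (I v)" if "v \<in> pverts G - S" for v
      using I(1) that by (simp add: V_def)
    show "I v \<subseteq> {t..t + 2 * pi}" if "v \<in> pverts G - S" for v
      using I(2)[of v] that by (force simp: V_def J_def cut_open_def)
    show "(u, v) \<in> parcs G \<longleftrightarrow> I u \<inter> I v \<noteq> {}"
      if "u \<in> pverts G - S" "v \<in> pverts G - S" "u \<noteq> v" for u v
      using I(3)[of u v] J_ne[of u v] F that
      by (auto simp: V_def circular_arc_rep_def intersection_rep_def)
  qed simp
  then show ?thesis by (simp add: S_def)
qed

theorem theorem4p1: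
  fixes G :: "'a pair_pre_digraph"
  assumes "circular_arc_graph G"
  shows "boxicity G \<le> r_inf G + 1"
proof -
  have G: "pair_graph G" and "{F. circular_arc_rep G F} \<noteq> {}"
    using assms by (auto simp: circular_arc_graph_def)
  \<comment> \<open>Both minima are attained, being infima of nonempty sets of naturals: a
    representation exists by assumption, and the circle has points.\<close>
  then have "r_inf G \<in> r_inf_family (pverts G) ` {F. circular_arc_rep G F}"
    unfolding r_inf_def by (intro Inf_nat_def1) simp
  then obtain F where F: "circular_arc_rep G F" "r_inf G = r_inf_family (pverts G) F"
    by blast
  have "r_inf_family (pverts G) F \<in> (\<lambda>P. card (overlap_set (pverts G) F P)) ` unit_circle"
    unfolding r_inf_family_def by (intro Inf_nat_def1) simp
  then obtain P where "P \<in> unit_circle"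
      "r_inf_family (pverts G) F = card (overlap_set (pverts G) F P)"
    by blast
  then show ?thesis
    using boxicity_le_card_overlap_set[OF G F(1)] F(2) by simp
qed

end
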